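(* The linear map $\partial$ is a derivation of the algebra $\mathbf{FQSym}$, that is, $\partial(fg)=\partial(f)\,g+f\,\partial(g)$ for all $f,g\in\mathbf{FQSym}$.
   Context: Let $K$ be a field of characteristic $0$. $\mathfrak{S}_n$ denotes the symmetric group on $\{1,\dots,n\}$ ($\mathfrak{S}_0$ consists of the empty permutation); a permutation $\sigma$ is identified with the word $\sigma(1)\sigma(2)\cdots\sigma(n)$. $\mathbf{FQSym}=\bigoplus_{n\ge 0}\mathbf{FQSym}_n$ is the graded $K$-algebra where $\mathbf{FQSym}_n$ has basis $(\mathbf{F}_\sigma)_{\sigma\in\mathfrak{S}_n}$, with product given, for $\alpha\in\mathfrak{S}_k$ and $\beta\in\mathfrak{S}_l$, by the shifted shuffle $$\mathbf{F}_\alpha\mathbf{F}_\beta=\sum_{\gamma}\mathbf{F}_\gamma,$$ where $\gamma$ runs over all words occurring in the shuffle of the word $\alpha$ with the word $\beta[k]$, whose $i$-th letter is $\beta_i+k$ (i.e. the permutations $\gamma\in\mathfrak{S}_{k+l}$ containing both $\alpha$ and $\beta[k]$ as subwords). The unit is $\mathbf{F}_\emptyset$. For $\sigma\in\mathfrak{S}_n$, let $\sigma'$ be the word $(n+1)\cdot\sigma\cdot 0$ obtained by adding the letter $n+1$ in front of $\sigma$ and the letter $0$ at the end. For $i\in\{1,\dots,n\}$, let $u_i$ (resp. $v_i$) be the letter that immediately precedes (resp. follows) the letter $i$ in $\sigma'$. Set $\mathrm{sgn}_i(\sigma)=+1$ if $u_i<i<v_i$, $\mathrm{sgn}_i(\sigma)=-1$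 if $u_i>i>v_i$, and $\mathrm{sgn}_i(\sigma)=0$ otherwise. Let $\mathrm{del}_i(\sigma)\in\mathfrak{S}_{n-1}$ be the standardization of the word obtained by deleting the letter $i$ from $\sigma$ (the permutation having its inversions at the same places as that word; equivalently, every letter greater than $i$ is decreased by $1$). $\partial$ is the linear endomorphism of $\mathbf{FQSym}$ (of degree $-1$) defined by $$\partial\,\mathbf{F}_\sigma=\sum_{i=1}^n \mathrm{sgn}_i(\sigma)\,\mathbf{F}_{\mathrm{del}_i(\sigma)}\qquad(\sigma\in\mathfrak{S}_n),$$ with $\partial\mathbf{F}_\emptyset=0$ for the empty permutation. *)

theory Defs
  imports Complex_Main "HOL-Library.Poly_Mapping"
begin

text \<open>The disjoint union of all symmetric groups; a permutation of \<open>{1..n}\<close> is its word of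
  length \<open>n\<close>.\<close>

typedef perm_word = "{w :: nat list. distinct w \<and> set w = {1..length w}}"
  morphisms word Perm
  by (rule exI[of _ "[]"]) simp

type_synonym 'k fqsym = "perm_word \<Rightarrow>\<^sub>0 'k"

definition F :: "perm_word \<Rightarrow> 'k::field_char_0 fqsym"
  where "F \<sigma> = Poly_Mapping.single \<sigma> 1"

definition scale :: "'k::field_char_0 \<Rightarrow> 'k fqsym \<Rightarrow> 'k fqsym"
  where "scale c f = Poly_Mapping.map (\<lambda>x. c * x) f"

text \<open>The letters of the two shuffled words are distinct, so no word occurs with
  multiplicity greater than one in the shuffle and a set of words suffices.\<close>

definition shifted_shuffle :: "perm_word \<Rightarrow> perm_word \<Rightarrow> perm_word set"
  where "shifted_shuffle \<alpha> \<beta> =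
    {\<gamma>. word \<gamma> \<in> shuffles (word \<alpha>) (map (\<lambda>b. b + length (word \<alpha>)) (word \<beta>))}"

text \<open>The multiplication of type \<open>perm_word \<Rightarrow>\<^sub>0 'k\<close> in the library is the convolution product
  over a monoid of keys, which is not the product of \<open>FQSym\<close>; hence a separate symbol.\<close>

definition fq_mult :: "'k::field_char_0 fqsym \<Rightarrow> 'k fqsym \<Rightarrow> 'k fqsym" (infixl \<open>\<star>\<close> 70)
  where "f \<star> g = (\<Sum>\<alpha>\<in>Poly_Mapping.keys f. \<Sum>\<beta>\<in>Poly_Mapping.keys g.
    scale (Poly_Mapping.lookup f \<alpha> * Poly_Mapping.lookup g \<beta>)
      (\<Sum>\<gamma>\<in>shifted_shuffle \<alpha> \<beta>. F \<gamma>))"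

definition extended_word :: "perm_word \<Rightarrow> nat list"
  where "extended_word \<sigma> = (length (word \<sigma>) + 1) # word \<sigma> @ [0]"

definition pred_letter :: "perm_word \<Rightarrow> nat \<Rightarrow> nat"
  where "pred_letter \<sigma> i = (THE u. \<exists>xs ys. extended_word \<sigma> = xs @ [u, i] @ ys)"

definition succ_letter :: "perm_word \<Rightarrow> nat \<Rightarrow> nat"
  where "succ_letter \<sigma> i = (THE v. \<exists>xs ys. extended_word \<sigma> = xs @ [i, v] @ ys)"

definition letter_sgn :: "nat \<Rightarrow> perm_word \<Rightarrow> int"
  where "letter_sgn i \<sigma> =
    (if pred_letter \<sigma> i < i \<and> i < succ_letter \<sigma> i then 1
     else if pred_letter \<sigma> i > i \<and> i > succ_letter \<sigma> i then - 1
     else 0)"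

text \<open>Standardization, for words without repeated letters.\<close>

definition standardize :: "nat list \<Rightarrow> nat list"
  where "standardize w = map (\<lambda>x. card {y \<in> set w. y \<le> x}) w"

definition del :: "nat \<Rightarrow> perm_word \<Rightarrow> perm_word"
  where "del i \<sigma> = Perm (standardize (removeAll i (word \<sigma>)))"

definition boundary_F :: "perm_word \<Rightarrow> 'k::field_char_0 fqsym"
  where "boundary_F \<sigma> =
    (\<Sum>i = 1..length (word \<sigma>). scale (of_int (letter_sgn i \<sigma>)) (F (del i \<sigma>)))"

definition boundary :: "'k::field_char_0 fqsym \<Rightarrow> 'k fqsym" (\<open>\<partial>\<close>)
  where "\<partial> f = (\<Sum>\<sigma>\<in>Poly_Mapping.keys f. scale (Poly_Mapping.lookup f \<sigma>) (boundary_F \<sigma>))"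


subsection \<open>Basic facts\<close>

lemma lookup_scale [simp]:
  "Poly_Mapping.lookup (scale c f) \<sigma> = c * Poly_Mapping.lookup f \<sigma>"
  unfolding scale_def by (simp add: map.rep_eq when_def)

lemma vector_space_scale: "vector_space scale"
  by unfold_locales (auto intro!: poly_mapping_eqI simp: lookup_add algebra_simps)

interpretation fqsym: vector_space scale
  by (rule vector_space_scale)

lemma scale_zero_left [simp]: "scale 0 f = 0"
  by (rule fqsym.scale_zero_left)

lemma distinct_word: "distinct (word \<sigma>)" and set_word: "set (word \<sigma>) = {1..length (word \<sigma>)}"
  using word[of \<sigma>] by auto

lemma lin_ext_superset:
  assumes "finite A" "Poly_Mapping.keys f \<subseteq> A"
  shows "(\<Sum>\<sigma>\<in>Poly_Mapping.keys f. scale (Poly_Mapping.lookup f \<sigma>) (b \<sigma>)) =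
    (\<Sum>\<sigma>\<in>A. scale (Poly_Mapping.lookup f \<sigma>) (b \<sigma>))"
  using assms by (intro sum.mono_neutral_left) (auto simp: in_keys_iff)

lemma linear_boundary:
  "Vector_Spaces.linear scale scale (\<partial> :: 'k::field_char_0 fqsym \<Rightarrow> 'k fqsym)"
proof -
  have "\<partial> (f + g) = \<partial> f + \<partial> g" for f g :: "'k fqsym"
  proof -
    let ?A = "Poly_Mapping.keys f \<union> Poly_Mapping.keys g"
    have "Poly_Mapping.keys (f + g) \<subseteq> ?A" by (rule Poly_Mapping.keys_add)
    then show ?thesis
      unfolding boundary_def
      by (subst (1 2 3) lin_ext_superset[of ?A])
        (auto simp: lookup_add fqsym.scale_left_distrib sum.distrib)
  qed
  moreover have "\<partial> (scale c f) = scale c (\<partial> f)" for c and f :: "'k fqsym"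
    unfolding boundary_def
    by (subst lin_ext_superset[of "Poly_Mapping.keys f"])
      (auto simp: in_keys_iff fqsym.scale_sum_right)
  ultimately show ?thesis
    by unfold_locales auto
qed

lemma boundary_basis: "\<partial> (F \<sigma>) = boundary_F \<sigma>"
  by (simp add: boundary_def F_def)

lemma word_image_shifted_shuffle:
  "word ` shifted_shuffle \<alpha> \<beta> =
    shuffles (word \<alpha>) (map (\<lambda>b. b + length (word \<alpha>)) (word \<beta>))"
    (is "_ = shuffles ?a ?b")
proof
  show "shuffles ?a ?b \<subseteq> word ` shifted_shuffle \<alpha> \<beta>"
  proof
    fix w assume w: "w \<in> shuffles ?a ?b"
    have l: "length w = length ?a + length (word \<beta>)"
      using length_shuffles[OF w] by simp
    have sb: "set ?b = (\<lambda>b. b + length (word \<alpha>)) ` {1..length (word \<beta>)}"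
      using set_word[of \<beta>] by simp
    have sb': "set ?b = {length (word \<alpha>) + 1..length (word \<alpha>) + length (word \<beta>)}"
      unfolding sb by (simp add: add.commute[of _ "length (word \<alpha>)"])
    have "set w = set ?a \<union> set ?b" using set_shuffles[OF w] .
    also have "\<dots> = {1..length w}"
      unfolding sb' set_word[of \<alpha>] l by auto
    finally have s: "set w = {1..length w}" .
    have "distinct w"
      using s by (simp add: card_distinct)
    then have "word (Perm w) = w" using s by (simp add: Perm_inverse)
    then show "w \<in> word ` shifted_shuffle \<alpha> \<beta>"
      using w by (intro image_eqI[of _ _ "Perm w"]) (auto simp: shifted_shuffle_def)
  qed
qed (auto simp: shifted_shuffle_def)

lemma finite_shifted_shuffle: "finite (shifted_shuffle \<alpha> \<beta>)"
  by (rule finite_imageD[of word])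
    (auto simp: word_image_shifted_shuffle inj_on_def word_inject)

lemma mult_basis: "F \<alpha> \<star> F \<beta> = (\<Sum>\<gamma>\<in>shifted_shuffle \<alpha> \<beta>. F \<gamma>)"
  by (simp add: fq_mult_def F_def)

lemma word_Nil: "word (Perm []) = []"
  by (simp add: Perm_inverse)

lemma lin_ext_F:
  "(\<Sum>\<sigma>\<in>Poly_Mapping.keys f. scale (Poly_Mapping.lookup f \<sigma>) (F \<sigma>)) = f"
  by (rule poly_mapping_eqI)
    (auto simp: lookup_sum F_def lookup_single when_def in_keys_iff if_distrib cong: if_cong)

lemma mult_one_left: "F (Perm []) \<star> f = f"
proof -
  have "shifted_shuffle (Perm []) \<beta> = {\<beta>}" for \<beta>
    by (auto simp: shifted_shuffle_def word_Nil word_inject)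
  then show ?thesis
    using lin_ext_F[of f] by (simp add: fq_mult_def F_def)
qed

lemma mult_one_right: "f \<star> F (Perm []) = f"
proof -
  have "shifted_shuffle \<alpha> (Perm []) = {\<alpha>}" for \<alpha>
    by (auto simp: shifted_shuffle_def word_Nil word_inject)
  then show ?thesis
    using lin_ext_F[of f] by (simp add: fq_mult_def F_def)
qed

lemma word_del:
  assumes "i \<in> {1..length (word \<sigma>)}"
  shows "word (del i \<sigma>) = map (\<lambda>x. if i < x then x - 1 else x) (removeAll i (word \<sigma>))"
proof -
  let ?r = "removeAll i (word \<sigma>)" and ?n = "length (word \<sigma>)"
  let ?h = "\<lambda>x. if i < x then x - 1 else x"
  have s: "set ?r = {1..?n} - {i}" using set_word[of \<sigma>] by simp
  have len: "length ?r = ?n - 1"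
    using distinct_word[of \<sigma>] assms set_word[of \<sigma>]
    by (simp add: distinct_remove1_removeAll[symmetric] length_remove1)
  have "standardize ?r = map ?h ?r"
    unfolding standardize_def
  proof (rule map_cong[OF refl])
    fix x assume "x \<in> set ?r"
    then have x: "x \<in> {1..?n}" "x \<noteq> i" unfolding s by auto
    have "{y \<in> set ?r. y \<le> x} = {1..x} - {i}" unfolding s using x by auto
    then show "card {y \<in> set ?r. y \<le> x} = ?h x"
      using x assms by (simp add: card_Diff_singleton_if)
  qed
  moreover have "distinct (map ?h ?r)"
    using distinct_word[of \<sigma>] assms
    by (auto simp: distinct_map distinct_removeAll inj_on_def split: if_splits)
  moreover have "set (map ?h ?r) = {1..length (map ?h ?r)}"
  proof -
    have "?h ` ({1..?n} - {i}) = {1..?n - 1}"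
    proof
      show "{1..?n - 1} \<subseteq> ?h ` ({1..?n} - {i})"
      proof
        fix y assume y: "y \<in> {1..?n - 1}"
        show "y \<in> ?h ` ({1..?n} - {i})"
        proof (cases "y < i")
          case True with y show ?thesis by (intro image_eqI[of _ _ y]) auto
        next
          case False with y show ?thesis by (intro image_eqI[of _ _ "Suc y"]) auto
        qed
      qed
    qed (use assms in auto)
    then show ?thesis using s len by simp
  qed
  ultimately show ?thesis
    by (simp add: del_def Perm_inverse del: set_map length_map)
qed

end

theory Submission
  imports Defs
begin

text \<open>
  The sign of a letter \<open>i\<close> between neighbours \<open>u\<close> and \<open>v\<close> is a difference
  \<open>[i < v] - [i < u]\<close>, where brackets denote truth values: for \<open>u < i < v\<close> this is \<open>1 - 0\<close>, for
  \<open>u > i > v\<close> it is \<open>0 - 1\<close>, and otherwise both brackets agree. Such differences telescope.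

  By bilinearity it suffices to treat \<open>F \<alpha> \<star> F \<beta>\<close>. Applying \<open>\<partial>\<close> to this product and exchanging
  sums yields, for each letter \<open>i\<close>, the sum over all words \<open>\<gamma>\<close> of the shuffle of the sign of \<open>i\<close>
  in \<open>\<gamma>\<close> times the word \<open>\<gamma>\<close> without \<open>i\<close>. Suppose \<open>i\<close> comes from \<open>\<alpha>\<close>, with neighbours \<open>u\<close> and \<open>v\<close>
  there. Fix a word \<open>w\<close> in the shuffle of \<open>\<alpha>\<close> without \<open>i\<close> and the shifted \<open>\<beta>\<close>. The words \<open>\<gamma>\<close> that become \<open>w\<close>
  when \<open>i\<close> is deleted arise by inserting \<open>i\<close> into any of the consecutive slots of \<open>w\<close> between \<open>u\<close> and \<open>v\<close>,
  and their signs telescope to \<open>[i < v] - [i < u]\<close>, the sign of \<open>i\<close> in \<open>\<alpha>\<close>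
  (\<open>slot_weight_telescope\<close>, \<open>sum_shuffles_insert_letter\<close>). So the letters of \<open>\<alpha>\<close> contribute
  \<open>\<partial> (F \<alpha>) \<star> F \<beta>\<close>. The argument never compares \<open>i\<close> with the letters of the other factor, so it applies
  equally to the letters of \<open>\<beta>\<close>, which contribute \<open>F \<alpha> \<star> \<partial> (F \<beta>)\<close>.

  The passage from words to permutations only requires that closing the gap left by \<open>i\<close> turns
  the shuffles with \<open>i\<close> deleted into shifted shuffles of permutations
  (\<open>sum_shifted_shuffle_delete_left\<close>, \<open>sum_shifted_shuffle_delete_right\<close>).
\<close>

section \<open>Inserting a letter into a shuffle\<close>

text \<open>The letters \<open>p\<close> and \<open>e\<close> play the part of the letters \<open>n + 1\<close> and \<open>0\<close> that frame a word,
  and the weight is that of the slot between \<open>x\<close> and \<open>y\<close>; with \<open>c z = [i < z]\<close> it becomes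
  the sign of \<open>i\<close> placed there.\<close>

definition slot_weight :: "('a \<Rightarrow> 'b::ab_group_add) \<Rightarrow> 'a \<Rightarrow> 'a \<Rightarrow> 'a list \<Rightarrow> 'a list \<Rightarrow> 'b"
  where "slot_weight c p e x y = c (hd (y @ [e])) - c (last (p # x))"

text \<open>The slots of \<open>w\<close> that separate the letters of \<open>xs\<close> from those of \<open>ys\<close> form an interval: it
  starts right after the last letter of \<open>xs\<close> and ends right before the first letter of \<open>ys\<close>, and
  the letters violating \<open>P\<close> in between cancel. The induction on \<open>w\<close> replaces \<open>p\<close> by the letter just
  passed.\<close>

lemma slot_weight_telescope:
  fixes c :: "'a \<Rightarrow> 'b::ab_group_add"
  assumes "filter P w = xs @ ys"
  shows "(\<Sum>j | j \<le> length w \<and> filter P (take j w) = xs.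
            slot_weight c p e (take j w) (drop j w)) = slot_weight c p e xs ys"
  using assms
proof (induction w arbitrary: p xs)
  case Nil
  then show ?case by (simp add: slot_weight_def)
next
  case (Cons z w)
  let ?S = "\<lambda>v xs. {j. j \<le> length v \<and> filter P (take j v) = xs}"
  have shift: "(\<Sum>j\<in>Suc ` J. slot_weight c p e (take j (z # w)) (drop j (z # w))) =
      (\<Sum>j\<in>J. slot_weight c z e (take j w) (drop j w))" for J
    by (simp add: sum.reindex slot_weight_def)
  have slots: "?S (z # w) xs = (if xs = [] then {0} else {}) \<union>
      Suc ` {j. j \<le> length w \<and> filter P (z # take j w) = xs}"
  proof (rule set_eqI)
    fix j show "j \<in> ?S (z # w) xs \<longleftrightarrow> j \<in> (if xs = [] then {0} else {}) \<union>
      Suc ` {j. j \<le> length w \<and> filter P (z # take j w) = xs}"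
      by (cases j) auto
  qed
  have split: "(\<Sum>j\<in>?S (z # w) xs. slot_weight c p e (take j (z # w)) (drop j (z # w))) =
      (if xs = [] then c z - c p else 0) +
      (\<Sum>j | j \<le> length w \<and> filter P (z # take j w) = xs.
         slot_weight c z e (take j w) (drop j w))"
    (is "sum ?f _ = ?z + sum ?g ?J")
  proof -
    have fin: "finite ?J" by (rule finite_subset[of _ "{..length w}"]) auto
    have "sum ?f (?S (z # w) xs) = sum ?f (if xs = [] then {0} else {}) + sum ?f (Suc ` ?J)"
      unfolding slots by (rule sum.union_disjoint) (use fin in auto)
    also have "sum ?f (if xs = [] then {0} else {}) = ?z"
      by (simp add: slot_weight_def)
    finally show ?thesis unfolding shift .
  qed
  show ?case
  proof (cases "P z")
    case True
    show ?thesis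
    proof (cases xs)
      case Nil
      then have "ys = z # filter P w" using Cons.prems True by simp
      then show ?thesis unfolding split using True Nil by (simp add: slot_weight_def)
    next
      case (Cons x xs')
      then have "x = z" "filter P w = xs' @ ys" using Cons.prems True by auto
      then show ?thesis unfolding split using True Cons Cons.IH[of xs' z]
        by (simp add: slot_weight_def)
    qed
  next
    case False
    then have "filter P w = xs @ ys" using Cons.prems by simp
    from Cons.IH[OF this, of z] show ?thesis
      unfolding split using False by (auto simp: slot_weight_def)
  qed
qed

definition letter_weight ::
    "('a \<Rightarrow> 'b::ab_group_add) \<Rightarrow> 'a \<Rightarrow> 'a \<Rightarrow> 'a \<Rightarrow> 'a list \<Rightarrow> 'b"
  where "letter_weight c p e i w =
    slot_weight c p e (takeWhile (\<lambda>x. x \<noteq> i) w) (tl (dropWhile (\<lambda>x. x \<noteq> i) w))"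

lemma letter_weight_append:
  "i \<notin> set x \<Longrightarrow> letter_weight c p e i (x @ i # y) = slot_weight c p e x y"
  by (simp add: letter_weight_def takeWhile_append dropWhile_append)

lemma in_shuffles_iff:
  assumes "\<And>x. x \<in> set xs \<Longrightarrow> P x" "\<And>y. y \<in> set ys \<Longrightarrow> \<not> P y"
  shows "zs \<in> shuffles xs ys \<longleftrightarrow> filter P zs = xs \<and> filter (\<lambda>x. \<not> P x) zs = ys"
proof -
  have "partition P -` {(xs, ys)} = shuffles xs ys"
    using assms by (rule inv_image_partition)
  then have "zs \<in> shuffles xs ys \<longleftrightarrow> partition P zs = (xs, ys)" by blast
  then show ?thesis by (simp add: comp_def)
qed

text \<open>Reordering the sum by \<open>w = removeAll i \<gamma>\<close>, the fibre over \<open>w\<close> corresponds to the slots \<open>j\<close> of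
  \<open>w\<close> that separate \<open>xs\<close> from \<open>ys\<close>, so its weights telescope to a value independent of \<open>w\<close>.\<close>

lemma sum_shuffles_insert_letter:
  fixes c :: "'a \<Rightarrow> int" and G :: "'a list \<Rightarrow> 'k::field_char_0 fqsym"
  assumes i: "i \<notin> set xs" "i \<notin> set ys" "i \<notin> set b"
    and disj: "set b \<inter> (set xs \<union> set ys) = {}"
  shows "(\<Sum>\<gamma>\<in>shuffles (xs @ i # ys) b.
            scale (of_int (letter_weight c p e i \<gamma>)) (G (removeAll i \<gamma>))) =
         scale (of_int (slot_weight c p e xs ys)) (\<Sum>w\<in>shuffles (xs @ ys) b. G w)"
proof -
  let ?P = "\<lambda>x. x \<notin> set b"
  let ?J = "\<lambda>w. {j. j \<le> length w \<and> filter ?P (take j w) = xs}"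
  have big: "\<gamma> \<in> shuffles (xs @ i # ys) b \<longleftrightarrow>
      filter ?P \<gamma> = xs @ i # ys \<and> filter (\<lambda>x. \<not> ?P x) \<gamma> = b" for \<gamma>
    by (rule in_shuffles_iff) (use i disj in auto)
  have small: "w \<in> shuffles (xs @ ys) b \<longleftrightarrow>
      filter ?P w = xs @ ys \<and> filter (\<lambda>x. \<not> ?P x) w = b" for w
    by (rule in_shuffles_iff) (use i disj in auto)
  have i_small: "i \<notin> set w" if "w \<in> shuffles (xs @ ys) b" for w
    using set_shuffles[OF that] i by auto
  have insert_big: "x @ i # y \<in> shuffles (xs @ i # ys) b"
    if w: "x @ y \<in> shuffles (xs @ ys) b" and x: "filter ?P x = xs" for x y
    using w x i unfolding big small by simp
  have remove_small: "removeAll i (x @ i # y) = x @ y \<and> x @ y \<in> shuffles (xs @ ys) b \<and>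
      length x \<in> ?J (x @ y) \<and> i \<notin> set x"
    if \<gamma>: "x @ i # y \<in> shuffles (xs @ i # ys) b" and x: "i \<notin> set x" for x y
  proof -
    have eq: "filter ?P x @ i # filter ?P y = xs @ i # ys"
      using \<gamma> i unfolding big by auto
    have "filter ?P x = xs"
      using arg_cong[OF eq, of "takeWhile (\<lambda>z. z \<noteq> i)"] x i
      by (auto simp: takeWhile_append split: if_splits)
    with eq have e: "filter ?P x = xs" "filter ?P y = ys" by simp_all
    have "i \<notin> set y" using e i by auto
    then show ?thesis using \<gamma> e x i unfolding big small by auto
  qed
  have split: "\<exists>x y. \<gamma> = x @ i # y \<and> i \<notin> set x" if "\<gamma> \<in> shuffles (xs @ i # ys) b" for \<gamma>
    using set_shuffles[OF that] by (intro split_list_first) auto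
  have "(\<Sum>\<gamma>\<in>shuffles (xs @ i # ys) b.
            scale (of_int (letter_weight c p e i \<gamma>)) (G (removeAll i \<gamma>))) =
        (\<Sum>(w, j)\<in>Sigma (shuffles (xs @ ys) b) ?J.
            scale (of_int (slot_weight c p e (take j w) (drop j w))) (G w))"
  proof (rule sum.reindex_bij_witness[where i = "\<lambda>(w, j). take j w @ i # drop j w"
        and j = "\<lambda>\<gamma>. (removeAll i \<gamma>, length (takeWhile (\<lambda>x. x \<noteq> i) \<gamma>))"])
    fix \<gamma> assume \<gamma>: "\<gamma> \<in> shuffles (xs @ i # ys) b"
    then obtain x y where g: "\<gamma> = x @ i # y" "i \<notin> set x" using split by blast
    have r: "removeAll i \<gamma> = x @ y" "x @ y \<in> shuffles (xs @ ys) b" "length x \<in> ?J (x @ y)"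
      using remove_small[of x y] \<gamma> g by auto
    have t: "takeWhile (\<lambda>x. x \<noteq> i) \<gamma> = x" using g by (auto simp: takeWhile_append)
    show "(case (removeAll i \<gamma>, length (takeWhile (\<lambda>x. x \<noteq> i) \<gamma>)) of
        (w, j) \<Rightarrow> take j w @ i # drop j w) = \<gamma>" unfolding r t using g by simp
    show "(removeAll i \<gamma>, length (takeWhile (\<lambda>x. x \<noteq> i) \<gamma>)) \<in> Sigma (shuffles (xs @ ys) b) ?J"
      unfolding r t using r by simp
    show "(case (removeAll i \<gamma>, length (takeWhile (\<lambda>x. x \<noteq> i) \<gamma>)) of
        (w, j) \<Rightarrow> scale (of_int (slot_weight c p e (take j w) (drop j w))) (G w)) =
        scale (of_int (letter_weight c p e i \<gamma>)) (G (removeAll i \<gamma>))"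
      unfolding r t using g by (simp add: letter_weight_append)
  next
    fix wj assume wj: "wj \<in> Sigma (shuffles (xs @ ys) b) ?J"
    obtain w j where [simp]: "wj = (w, j)" by (cases wj)
    have w: "w \<in> shuffles (xs @ ys) b" and j: "j \<in> ?J w" using wj by auto
    have "i \<notin> set (take j w)" "i \<notin> set (drop j w)"
      using i_small[OF w] by (auto dest: in_set_takeD in_set_dropD)
    then show "(removeAll i (case wj of (w, j) \<Rightarrow> take j w @ i # drop j w),
        length (takeWhile (\<lambda>x. x \<noteq> i) (case wj of (w, j) \<Rightarrow> take j w @ i # drop j w))) = wj"
      using j by (auto simp: takeWhile_append)
    show "(case wj of (w, j) \<Rightarrow> take j w @ i # drop j w) \<in> shuffles (xs @ i # ys) b"
      using insert_big[of "take j w" "drop j w"] w j by simp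
  qed
  also have "\<dots> = (\<Sum>w\<in>shuffles (xs @ ys) b. \<Sum>j\<in>?J w.
            scale (of_int (slot_weight c p e (take j w) (drop j w))) (G w))"
    by (subst sum.Sigma) auto
  also have "\<dots> = (\<Sum>w\<in>shuffles (xs @ ys) b. scale (of_int (slot_weight c p e xs ys)) (G w))"
  proof (rule sum.cong[OF refl])
    fix w assume "w \<in> shuffles (xs @ ys) b"
    then have "filter ?P w = xs @ ys" unfolding small by simp
    from slot_weight_telescope[OF this, of c p e]
    show "(\<Sum>j\<in>?J w. scale (of_int (slot_weight c p e (take j w) (drop j w))) (G w)) =
        scale (of_int (slot_weight c p e xs ys)) (G w)"
      by (simp flip: fqsym.scale_sum_left of_int_sum)
  qed
  finally show ?thesis by (simp add: fqsym.scale_sum_right)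
qed

section \<open>Signs of letters as slot weights\<close>

abbreviation slot_sgn :: "nat \<Rightarrow> nat list \<Rightarrow> nat list \<Rightarrow> int"
  where "slot_sgn i \<equiv> slot_weight (\<lambda>z. of_bool (i < z)) (Suc i) 0"

text \<open>Only the truth value \<open>i < u\<close> of the letter before \<open>i\<close> matters, so the framing letter \<open>n + 1\<close>
  can be replaced by \<open>Suc i\<close>. This makes the sign independent of the length of the word, as needed
  to compare a letter of a factor with the same letter in the product.\<close>

lemma letter_sgn_eq_slot_sgn:
  assumes w: "word \<sigma> = x @ i # y"
  shows "letter_sgn i \<sigma> = slot_sgn i x y"
proof -
  let ?n = "length (word \<sigma>)"
  have d: "distinct (extended_word \<sigma>)"
    using distinct_word[of \<sigma>] set_word[of \<sigma>] by (auto simp: extended_word_def)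
  have "i \<in> set (word \<sigma>)" using w by simp
  then have i: "1 \<le> i" "i \<le> ?n" unfolding set_word by auto
  have ew: "extended_word \<sigma> = ((?n + 1) # x) @ i # (y @ [0])"
    by (simp add: extended_word_def w)
  obtain xs u where u: "(?n + 1) # x = xs @ [u]" by (metis rev_exhaust list.distinct(1))
  obtain v ys where v: "y @ [0] = v # ys" by (metis list.exhaust snoc_eq_iff_butlast)
  have uv: "u = last ((?n + 1) # x)" "v = hd (y @ [0])" unfolding u v by simp_all
  have uniq: "a = ((?n + 1) # x) \<and> b = y @ [0]" if "extended_word \<sigma> = a @ i # b" for a b
  proof -
    have "i \<notin> set a" "i \<notin> set b" using d unfolding that by auto
    moreover have "a @ i # b = ((?n + 1) # x) @ i # (y @ [0])" using that ew by simp
    ultimately show ?thesis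
      by (meson append_Cons_eq_iff)
  qed
  have p: "pred_letter \<sigma> i = u"
    unfolding pred_letter_def
  proof (rule the_equality)
    show "\<exists>xs ys. extended_word \<sigma> = xs @ [u, i] @ ys"
      unfolding ew u by auto
  next
    fix u' assume "\<exists>xs ys. extended_word \<sigma> = xs @ [u', i] @ ys"
    then obtain a b where "extended_word \<sigma> = (a @ [u']) @ i # b" by auto
    from uniq[OF this] have "a @ [u'] = (?n + 1) # x" by simp
    then show "u' = u" unfolding u by simp
  qed
  have s: "succ_letter \<sigma> i = v"
    unfolding succ_letter_def
  proof (rule the_equality)
    show "\<exists>xs ys. extended_word \<sigma> = xs @ [i, v] @ ys"
      unfolding ew v by (intro exI[of _ "(?n + 1) # x"] exI[of _ ys]) simp
  next
    fix v' assume "\<exists>xs ys. extended_word \<sigma> = xs @ [i, v'] @ ys"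
    then obtain a b where "extended_word \<sigma> = a @ i # (v' # b)" by auto
    from uniq[OF this] show "v' = v" unfolding v by simp
  qed
  have ne: "u \<noteq> i" "v \<noteq> i" using d unfolding ew u v by auto
  have left: "i < last (Suc i # x) \<longleftrightarrow> i < u" using i uv by (cases x) auto
  then show ?thesis
    using ne unfolding letter_sgn_def p s slot_weight_def uv(2)[symmetric] left by auto
qed

lemma letter_sgn_eq_letter_weight:
  assumes "i \<in> {1..length (word \<sigma>)}"
  shows "letter_sgn i \<sigma> = letter_weight (\<lambda>z. of_bool (i < z)) (Suc i) 0 i (word \<sigma>)"
proof -
  have "i \<in> set (word \<sigma>)" using assms by (simp add: set_word)
  from split_list_first[OF this] obtain x y where w: "word \<sigma> = x @ i # y" "i \<notin> set x" by blast
  show ?thesis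
    using letter_sgn_eq_slot_sgn[OF w(1)] w by (simp add: letter_weight_append)
qed

lemma slot_sgn_shift:
  "slot_sgn (i + k) (map (\<lambda>b. b + k) x) (map (\<lambda>b. b + k) y) = slot_sgn i x y"
  by (cases x rule: rev_cases; cases y) (auto simp: slot_weight_def)

section \<open>Deleting a letter from a shifted shuffle\<close>

abbreviation close_gap :: "nat \<Rightarrow> nat \<Rightarrow> nat"
  where "close_gap i \<equiv> \<lambda>x. if i < x then x - 1 else x"

lemma inj_on_close_gap: "i \<notin> A \<Longrightarrow> inj_on (close_gap i) A"
proof (rule inj_onI)
  fix x y assume "i \<notin> A" "x \<in> A" "y \<in> A" "close_gap i x = close_gap i y"
  moreover from this have "x \<noteq> i" "y \<noteq> i" by auto
  ultimately show "x = y" by (auto split: if_splits)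
qed

lemma map_shuffles: "map f ` shuffles xs ys = shuffles (map f xs) (map f ys)"
proof (induction xs ys rule: shuffles.induct)
  case (3 x xs y ys)
  show ?case
    by (simp add: image_Un image_image flip: "3.IH"[unfolded list.map])
qed simp_all

abbreviation shifted_word :: "nat \<Rightarrow> perm_word \<Rightarrow> nat list"
  where "shifted_word k \<beta> \<equiv> map (\<lambda>b. b + k) (word \<beta>)"

text \<open>Common form of the two cases below: the factor that contains \<open>i\<close> is written \<open>x @ i # y\<close>, the
  other one \<open>b\<close>, both with the letters they have in the product.\<close>

lemma sum_shifted_shuffle_delete_letter:
  fixes \<alpha> \<beta> :: perm_word
  defines "k \<equiv> length (word \<alpha>)"
  assumes n: "length (word \<alpha>) + length (word \<beta>) = n" and i: "i \<in> {1..n}"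
    and sh: "shuffles (word \<alpha>) (shifted_word k \<beta>) = shuffles (x @ i # y) b"
    and dist: "distinct (x @ i # y @ b)"
    and del: "map (close_gap i) ` shuffles (x @ y) b = word ` shifted_shuffle \<alpha>' \<beta>'"
  shows "(\<Sum>\<gamma>\<in>shifted_shuffle \<alpha> \<beta>. scale (of_int (letter_sgn i \<gamma>)) (F (del i \<gamma>))) =
    scale (of_int (slot_sgn i x y)) (F \<alpha>' \<star> F \<beta>' :: 'k::field_char_0 fqsym)"
proof -
  let ?c = "\<lambda>z. of_bool (i < z) :: int"
  let ?G = "\<lambda>w. F (Perm (map (close_gap i) w)) :: 'k fqsym"
  have inj: "inj_on word A" for A by (simp add: inj_on_def word_inject)
  have len: "length (word \<gamma>) = n" if "\<gamma> \<in> shifted_shuffle \<alpha> \<beta>" for \<gamma>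
    using that n length_shuffles by (fastforce simp: shifted_shuffle_def)
  have "(\<Sum>\<gamma>\<in>shifted_shuffle \<alpha> \<beta>. scale (of_int (letter_sgn i \<gamma>)) (F (del i \<gamma>))) =
      (\<Sum>\<gamma>\<in>shifted_shuffle \<alpha> \<beta>. scale (of_int (letter_weight ?c (Suc i) 0 i (word \<gamma>)))
         (?G (removeAll i (word \<gamma>))))"
  proof (rule sum.cong[OF refl])
    fix \<gamma> assume "\<gamma> \<in> shifted_shuffle \<alpha> \<beta>"
    then have i: "i \<in> {1..length (word \<gamma>)}" using i len by simp
    have "del i \<gamma> = Perm (map (close_gap i) (removeAll i (word \<gamma>)))"
      using word_del[OF i] by (metis word_inverse)
    then show "scale (of_int (letter_sgn i \<gamma>)) (F (del i \<gamma>)) =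
        scale (of_int (letter_weight ?c (Suc i) 0 i (word \<gamma>))) (?G (removeAll i (word \<gamma>)))"
      using letter_sgn_eq_letter_weight[OF i] by simp
  qed
  also have "\<dots> = (\<Sum>w\<in>shuffles (x @ i # y) b.
      scale (of_int (letter_weight ?c (Suc i) 0 i w)) (?G (removeAll i w)))"
    unfolding sh[symmetric] k_def word_image_shifted_shuffle[symmetric]
    by (simp add: sum.reindex[OF inj])
  also have "\<dots> = scale (of_int (slot_sgn i x y)) (\<Sum>w\<in>shuffles (x @ y) b. ?G w)"
    by (rule sum_shuffles_insert_letter) (use dist in auto)
  also have "(\<Sum>w\<in>shuffles (x @ y) b. ?G w) =
      (\<Sum>w\<in>map (close_gap i) ` shuffles (x @ y) b. F (Perm w))"
  proof (rule sum.reindex[symmetric, unfolded comp_def])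
    have "inj_on (map (close_gap i)) (lists (- {i}))"
      by (intro inj_on_mapI inj_on_close_gap) auto
    moreover have "shuffles (x @ y) b \<subseteq> lists (- {i})"
      using dist by (auto dest!: set_shuffles)
    ultimately show "inj_on (map (close_gap i)) (shuffles (x @ y) b)"
      by (rule inj_on_subset)
  qed
  also have "\<dots> = F \<alpha>' \<star> F \<beta>'"
    unfolding del by (simp add: sum.reindex[OF inj] word_inverse mult_basis)
  finally show ?thesis .
qed

lemma distinct_shifted_shuffle:
  "distinct (word \<alpha> @ shifted_word (length (word \<alpha>)) \<beta>)"
  using distinct_word[of \<alpha>] distinct_word[of \<beta>] set_word[of \<alpha>] set_word[of \<beta>]
  by (auto simp: distinct_map)

text \<open>Every letter of the shifted \<open>\<beta>\<close> exceeds \<open>i\<close> and is decreased by 1 when the gap is closed;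
  this is the shift by the length of \<open>del i \<alpha>\<close>.\<close>

lemma sum_shifted_shuffle_delete_left:
  assumes i: "i \<in> {1..length (word \<alpha>)}"
  shows "(\<Sum>\<gamma>\<in>shifted_shuffle \<alpha> \<beta>. scale (of_int (letter_sgn i \<gamma>)) (F (del i \<gamma>))) =
    scale (of_int (letter_sgn i \<alpha>)) (F (del i \<alpha>) \<star> F \<beta> :: 'k::field_char_0 fqsym)"
proof -
  let ?k = "length (word \<alpha>)"
  have "i \<in> set (word \<alpha>)" using i by (simp add: set_word)
  from split_list[OF this] obtain x y where w: "word \<alpha> = x @ i # y" by blast
  have dist: "distinct (x @ i # y @ shifted_word ?k \<beta>)"
    using distinct_shifted_shuffle[of \<alpha> \<beta>] unfolding w by simp
  have wd: "word (del i \<alpha>) = map (close_gap i) (x @ y)"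
    unfolding word_del[OF i] w using dist by simp
  then have "length (word (del i \<alpha>)) = ?k - 1" using w by simp
  moreover have "map (close_gap i) (shifted_word ?k \<beta>) = shifted_word (?k - 1) \<beta>"
    using i set_word[of \<beta>] by auto
  ultimately have "map (close_gap i) (shifted_word ?k \<beta>) = shifted_word (length (word (del i \<alpha>))) \<beta>"
    by (simp only:)
  then have del: "map (close_gap i) ` shuffles (x @ y) (shifted_word ?k \<beta>) =
      word ` shifted_shuffle (del i \<alpha>) \<beta>"
    unfolding word_image_shifted_shuffle map_shuffles by (simp only: wd)
  show ?thesis
    unfolding letter_sgn_eq_slot_sgn[OF w]
    by (rule sum_shifted_shuffle_delete_letter[OF refl _ _ dist del]) (use i w in auto)
qed

text \<open>Here closing the gap fixes \<open>\<alpha>\<close> and commutes with the shift of \<open>\<beta>\<close>. Commutativity of the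
  shuffle of words puts the factor containing the deleted letter first.\<close>

lemma sum_shifted_shuffle_delete_right:
  assumes i: "i \<in> {1..length (word \<beta>)}"
  shows "(\<Sum>\<gamma>\<in>shifted_shuffle \<alpha> \<beta>. scale (of_int (letter_sgn (i + length (word \<alpha>)) \<gamma>))
      (F (del (i + length (word \<alpha>)) \<gamma>))) =
    scale (of_int (letter_sgn i \<beta>)) (F \<alpha> \<star> F (del i \<beta>) :: 'k::field_char_0 fqsym)"
proof -
  let ?k = "length (word \<alpha>)"
  let ?s = "map (\<lambda>b. b + ?k)"
  have "i \<in> set (word \<beta>)" using i by (simp add: set_word)
  from split_list[OF this] obtain x y where w: "word \<beta> = x @ i # y" by blast
  have dist: "distinct (?s x @ (i + ?k) # ?s y @ word \<alpha>)"
    using distinct_shifted_shuffle[of \<alpha> \<beta>] unfolding w by auto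
  have "distinct (x @ i # y)" using distinct_word[of \<beta>] unfolding w .
  then have wd: "word (del i \<beta>) = map (close_gap i) (x @ y)"
    unfolding word_del[OF i] w by simp
  have "map (close_gap (i + ?k)) (word \<alpha>) = word \<alpha>"
    using i set_word[of \<alpha>] by (intro map_idI) auto
  moreover have "map (close_gap (i + ?k)) (?s x @ ?s y) = ?s (word (del i \<beta>))"
    unfolding wd by auto
  ultimately have del: "map (close_gap (i + ?k)) ` shuffles (?s x @ ?s y) (word \<alpha>) =
      word ` shifted_shuffle \<alpha> (del i \<beta>)"
    unfolding word_image_shifted_shuffle map_shuffles
    by (simp only: shuffles_commutes[of "word \<alpha>"])
  have sh: "shuffles (word \<alpha>) (shifted_word ?k \<beta>) = shuffles (?s x @ (i + ?k) # ?s y) (word \<alpha>)"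
    unfolding w by (subst shuffles_commutes) simp
  show ?thesis
    unfolding letter_sgn_eq_slot_sgn[OF w]
    unfolding slot_sgn_shift[of i ?k x y, symmetric]
    by (rule sum_shifted_shuffle_delete_letter[OF refl _ sh dist del]) (use i in auto)
qed

section \<open>Bilinearity and the Leibniz rule\<close>

lemma fq_mult_superset:
  assumes "finite A" "Poly_Mapping.keys f \<subseteq> A" "finite B" "Poly_Mapping.keys g \<subseteq> B"
  shows "f \<star> g = (\<Sum>\<alpha>\<in>A. \<Sum>\<beta>\<in>B.
    scale (Poly_Mapping.lookup f \<alpha> * Poly_Mapping.lookup g \<beta>) (F \<alpha> \<star> F \<beta>))"
proof -
  have "f \<star> g = (\<Sum>\<alpha>\<in>Poly_Mapping.keys f. \<Sum>\<beta>\<in>B.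
    scale (Poly_Mapping.lookup f \<alpha> * Poly_Mapping.lookup g \<beta>) (F \<alpha> \<star> F \<beta>))"
    unfolding fq_mult_def[of f g] mult_basis
    by (intro sum.cong sum.mono_neutral_left refl) (use assms in \<open>auto simp: in_keys_iff\<close>)
  also have "\<dots> = (\<Sum>\<alpha>\<in>A. \<Sum>\<beta>\<in>B.
    scale (Poly_Mapping.lookup f \<alpha> * Poly_Mapping.lookup g \<beta>) (F \<alpha> \<star> F \<beta>))"
    by (intro sum.mono_neutral_left) (use assms in \<open>auto simp: in_keys_iff\<close>)
  finally show ?thesis .
qed

lemma linear_fq_mult_left: "Vector_Spaces.linear scale scale (\<lambda>f. f \<star> g)"
proof -
  have "(f1 + f2) \<star> g = f1 \<star> g + f2 \<star> g" for f1 f2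
  proof -
    let ?A = "Poly_Mapping.keys f1 \<union> Poly_Mapping.keys f2"
    have "Poly_Mapping.keys (f1 + f2) \<subseteq> ?A" by (rule Poly_Mapping.keys_add)
    then show ?thesis
      by (subst (1 2 3) fq_mult_superset[of ?A _ "Poly_Mapping.keys g"])
        (auto simp: lookup_add distrib_right fqsym.scale_left_distrib sum.distrib)
  qed
  moreover have "scale r f \<star> g = scale r (f \<star> g)" for r f
    by (subst (1 2) fq_mult_superset[of "Poly_Mapping.keys f" _ "Poly_Mapping.keys g"])
      (auto simp: in_keys_iff fqsym.scale_sum_right mult.assoc)
  ultimately show ?thesis by unfold_locales auto
qed

lemma linear_fq_mult_right: "Vector_Spaces.linear scale scale (\<lambda>g. f \<star> g)"
proof -
  have "f \<star> (g1 + g2) = f \<star> g1 + f \<star> g2" for g1 g2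
  proof -
    let ?B = "Poly_Mapping.keys g1 \<union> Poly_Mapping.keys g2"
    have "Poly_Mapping.keys (g1 + g2) \<subseteq> ?B" by (rule Poly_Mapping.keys_add)
    then show ?thesis
      by (subst (1 2 3) fq_mult_superset[of "Poly_Mapping.keys f" _ ?B])
        (auto simp: lookup_add distrib_left fqsym.scale_left_distrib sum.distrib)
  qed
  moreover have "f \<star> scale r g = scale r (f \<star> g)" for r g
    by (subst (1 2) fq_mult_superset[of "Poly_Mapping.keys f" _ "Poly_Mapping.keys g"])
      (auto simp: in_keys_iff fqsym.scale_sum_right mult.left_commute)
  ultimately show ?thesis by unfold_locales auto
qed

lemmas linear_simps =
  module_hom.zero[OF Vector_Spaces.linear.axioms(3)]
  module_hom.add[OF Vector_Spaces.linear.axioms(3)]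
  module_hom.scale[OF Vector_Spaces.linear.axioms(3)]
  module_hom.sum[OF Vector_Spaces.linear.axioms(3)]

lemma fqsym_linear_induct [case_names zero add scale basis]:
  assumes "P 0" "\<And>f g. P f \<Longrightarrow> P g \<Longrightarrow> P (f + g)" "\<And>c f. P f \<Longrightarrow> P (scale c f)"
    and "\<And>\<sigma>. P (F \<sigma>)"
  shows "P f"
proof -
  have "P (\<Sum>\<sigma>\<in>A. scale (Poly_Mapping.lookup f \<sigma>) (F \<sigma>))" if "finite A" for A
    using that by (induction A) (auto intro: assms)
  from this[of "Poly_Mapping.keys f"] show ?thesis by (simp add: lin_ext_F)
qed

lemma boundary_mult_basis:
  "\<partial> (F \<alpha> \<star> F \<beta>) = \<partial> (F \<alpha>) \<star> F \<beta> + F \<alpha> \<star> \<partial> (F \<beta> :: 'k::field_char_0 fqsym)"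
proof -
  let ?k = "length (word \<alpha>)" and ?l = "length (word \<beta>)"
  let ?t = "\<lambda>\<gamma> i. scale (of_int (letter_sgn i \<gamma>)) (F (del i \<gamma>)) :: 'k fqsym"
  have "\<partial> (F \<alpha> \<star> F \<beta>) = (\<Sum>\<gamma>\<in>shifted_shuffle \<alpha> \<beta>. \<partial> (F \<gamma> :: 'k fqsym))"
    unfolding mult_basis by (rule linear_simps(4)[OF linear_boundary])
  also have "\<dots> = (\<Sum>\<gamma>\<in>shifted_shuffle \<alpha> \<beta>. \<Sum>i\<in>{1..?k + ?l}. ?t \<gamma> i)"
  proof (rule sum.cong[OF refl])
    fix \<gamma> assume "\<gamma> \<in> shifted_shuffle \<alpha> \<beta>"
    then have "length (word \<gamma>) = ?k + ?l"
      using length_shuffles by (fastforce simp: shifted_shuffle_def)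
    then show "\<partial> (F \<gamma>) = (\<Sum>i\<in>{1..?k + ?l}. ?t \<gamma> i)"
      by (simp add: boundary_basis boundary_F_def)
  qed
  also have "\<dots> = (\<Sum>i\<in>{1..?k + ?l}. \<Sum>\<gamma>\<in>shifted_shuffle \<alpha> \<beta>. ?t \<gamma> i)"
    by (rule sum.swap)
  also have "\<dots> = (\<Sum>i\<in>{1..?k}. \<Sum>\<gamma>\<in>shifted_shuffle \<alpha> \<beta>. ?t \<gamma> i) +
      (\<Sum>i\<in>{1..?l}. \<Sum>\<gamma>\<in>shifted_shuffle \<alpha> \<beta>. ?t \<gamma> (i + ?k))"
    using sum.ub_add_nat[of 1 ?k "\<lambda>i. \<Sum>\<gamma>\<in>shifted_shuffle \<alpha> \<beta>. ?t \<gamma> i" ?l]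
      sum.shift_bounds_cl_nat_ivl[of "\<lambda>i. \<Sum>\<gamma>\<in>shifted_shuffle \<alpha> \<beta>. ?t \<gamma> i" 1 ?k ?l]
    by (simp add: add.commute)
  also have "(\<Sum>i\<in>{1..?k}. \<Sum>\<gamma>\<in>shifted_shuffle \<alpha> \<beta>. ?t \<gamma> i) = \<partial> (F \<alpha>) \<star> F \<beta>"
    unfolding boundary_basis boundary_F_def linear_simps(4)[OF linear_fq_mult_left]
    by (simp add: sum_shifted_shuffle_delete_left linear_simps(3)[OF linear_fq_mult_left])
  also have "(\<Sum>i\<in>{1..?l}. \<Sum>\<gamma>\<in>shifted_shuffle \<alpha> \<beta>. ?t \<gamma> (i + ?k)) = F \<alpha> \<star> \<partial> (F \<beta>)"
    unfolding boundary_basis boundary_F_def linear_simps(4)[OF linear_fq_mult_right]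
    by (simp add: sum_shifted_shuffle_delete_right linear_simps(3)[OF linear_fq_mult_right])
  finally show ?thesis .
qed

lemma boundary_mult:
  "\<partial> (f \<star> g) = \<partial> f \<star> g + f \<star> \<partial> (g :: 'k::field_char_0 fqsym)"
proof -
  note lin = linear_simps(1-3)[OF linear_boundary] linear_simps(1-3)[OF linear_fq_mult_left]
    linear_simps(1-3)[OF linear_fq_mult_right]
  show ?thesis
  proof (induction f rule: fqsym_linear_induct)
    case (basis \<alpha>)
    show ?case
      by (induction g rule: fqsym_linear_induct)
        (simp_all add: lin boundary_mult_basis algebra_simps)
  qed (simp_all add: lin algebra_simps)
qed

theorem proposition3p2:
  "Vector_Spaces.linear scale scale (\<partial> :: 'k::field_char_0 fqsym \<Rightarrow> 'k fqsym) \<and>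
    (\<forall>f g :: 'k fqsym. \<partial> (f \<star> g) = \<partial> f \<star> g + f \<star> \<partial> g)"
  using linear_boundary boundary_mult by blast

end
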